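(* Let $H$ be a Hopf algebra over a field $k$, and let $\int_l\subseteq H^*$ be the $k$-vector space of left integrals of $H$. Then the dimension of $\int_l$ over $k$ is at most one.
   Context: $H^*=\mathrm{Hom}_k(H,k)$ is the dual algebra of the coalgebra $H$, with convolution product $(\alpha\beta)(h)=\alpha(h_1)\beta(h_2)$ (Sweedler notation $\Delta(h)=h_1\otimes h_2$). A left integral of $H$ is an element $\lambda\in H^*$ such that $\alpha\lambda=\alpha(1)\lambda$ for all $\alpha\in H^*$; the space of left integrals is denoted $\int_l$. $H$ is not assumed to be finite dimensional. *)

theory Defs
  imports Complex_Main "HOL-Library.Poly_Mapping" "HOL-Library.Function_Algebras"
begin

section \<open>Formal linear combinations\<close>

definition formal_scale :: "'k::field \<Rightarrow> ('x \<Rightarrow>\<^sub>0 'k) \<Rightarrow> ('x \<Rightarrow>\<^sub>0 'k)" where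
  "formal_scale c p = Poly_Mapping.map ((*) c) p"

abbreviation formal_gen :: "'x \<Rightarrow> ('x \<Rightarrow>\<^sub>0 'k::field)" where
  "formal_gen x \<equiv> Poly_Mapping.single x 1"

definition formal_extend ::
    "('k::field \<Rightarrow> 'v \<Rightarrow> 'v) \<Rightarrow> ('x \<Rightarrow> 'v::ab_group_add) \<Rightarrow> ('x \<Rightarrow>\<^sub>0 'k) \<Rightarrow> 'v" where
  "formal_extend scaleV f p =
     (\<Sum>x\<in>Poly_Mapping.keys p. scaleV (Poly_Mapping.lookup p x) (f x))"

lemma lookup_formal_scale [simp]:
  "Poly_Mapping.lookup (formal_scale c p) x = c * Poly_Mapping.lookup p x"
  unfolding formal_scale_def by (cases "Poly_Mapping.lookup p x = 0") (simp_all add: map.rep_eq)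

lemma vector_space_formal_scale: "vector_space (formal_scale :: 'k::field \<Rightarrow> ('x \<Rightarrow>\<^sub>0 'k) \<Rightarrow> _)"
  by unfold_locales (auto intro!: poly_mapping_eqI simp: lookup_add algebra_simps)


section \<open>Tensor powers\<close>

text \<open>
  The tensor power of a vector space \<open>H\<close> is the quotient of the space of formal linear
  combinations of tuples by the span of the multilinearity relations; its elements are cosets.
  A set \<open>slots\<close> of maps \<open>\<phi>\<close> inserting one argument into an otherwise fixed tuple says
  which relations are imposed: \<open>\<phi>\<close> is to be linear modulo the relations. The threefold
  power is taken in this flat form rather than as an iterated twofold one.
\<close>

definition multilinear_relations ::
    "('k::field \<Rightarrow> 'h::ab_group_add \<Rightarrow> 'h) \<Rightarrow> ('h \<Rightarrow> 'x) set \<Rightarrow> ('x \<Rightarrow>\<^sub>0 'k) set" where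
  "multilinear_relations scale slots = module.span formal_scale
     ({formal_gen (\<phi> (a + b)) - formal_gen (\<phi> a) - formal_gen (\<phi> b) | \<phi> a b. \<phi> \<in> slots} \<union>
      {formal_gen (\<phi> (scale c a)) - formal_scale c (formal_gen (\<phi> a)) | \<phi> c a. \<phi> \<in> slots})"

definition tensor_class ::
    "('k::field \<Rightarrow> 'h::ab_group_add \<Rightarrow> 'h) \<Rightarrow> ('h \<Rightarrow> 'x) set \<Rightarrow> ('x \<Rightarrow>\<^sub>0 'k) \<Rightarrow> ('x \<Rightarrow>\<^sub>0 'k) set" where
  "tensor_class scale slots p = {q. q - p \<in> multilinear_relations scale slots}"

definition slots2 :: "('h \<Rightarrow> 'h \<times> 'h) set" where
  "slots2 = {\<lambda>x. (x, b) | b. True} \<union> {\<lambda>x. (a, x) | a. True}"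

definition slots3 :: "('h \<Rightarrow> 'h \<times> 'h \<times> 'h) set" where
  "slots3 = {\<lambda>x. (x, b, c) | b c. True} \<union> {\<lambda>x. (a, x, c) | a c. True} \<union> {\<lambda>x. (a, b, x) | a b. True}"

abbreviation tensor_class2 ::
    "('k::field \<Rightarrow> 'h::ab_group_add \<Rightarrow> 'h) \<Rightarrow> ('h \<times> 'h \<Rightarrow>\<^sub>0 'k) \<Rightarrow> ('h \<times> 'h \<Rightarrow>\<^sub>0 'k) set" where
  "tensor_class2 scale \<equiv> tensor_class scale slots2"

abbreviation tensor_class3 ::
    "('k::field \<Rightarrow> 'h::ab_group_add \<Rightarrow> 'h) \<Rightarrow> ('h \<times> 'h \<times> 'h \<Rightarrow>\<^sub>0 'k) \<Rightarrow> ('h \<times> 'h \<times> 'h \<Rightarrow>\<^sub>0 'k) set" where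
  "tensor_class3 scale \<equiv> tensor_class scale slots3"

definition tensor_square ::
    "('k::field \<Rightarrow> 'h::ab_group_add \<Rightarrow> 'h) \<Rightarrow> ('h \<times> 'h \<Rightarrow>\<^sub>0 'k) set set" where
  "tensor_square scale = range (tensor_class2 scale)"

definition tensor_rep :: "('x \<Rightarrow>\<^sub>0 'k::field) set \<Rightarrow> ('x \<Rightarrow>\<^sub>0 'k)" where
  "tensor_rep T = (SOME p. p \<in> T)"

text \<open>
  For a coset \<open>T = \<Delta> h\<close>, the value \<open>tensor_lift scaleV f T\<close> is what Sweedler notation writes as
  \<open>f (h\<^sub>1, h\<^sub>2)\<close>. It does not depend on the representative when \<open>f\<close> is multilinear, see
  \<open>tensor_lift_class\<close> below. If \<open>f\<close> takes values in formal combinations that are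
  multilinear only modulo relations, the result is meaningful modulo those relations, so it has to
  be wrapped in \<open>tensor_class\<close>.
\<close>

definition tensor_lift ::
    "('k::field \<Rightarrow> 'v \<Rightarrow> 'v) \<Rightarrow> ('x \<Rightarrow> 'v::ab_group_add) \<Rightarrow> ('x \<Rightarrow>\<^sub>0 'k) set \<Rightarrow> 'v" where
  "tensor_lift scaleV f T = formal_extend scaleV f (tensor_rep T)"

lemma linear_formal_extend:
  fixes scaleV :: "'k::field \<Rightarrow> 'v::ab_group_add \<Rightarrow> 'v"
  assumes "vector_space scaleV"
  shows "Vector_Spaces.linear formal_scale scaleV (formal_extend scaleV (f :: 'x \<Rightarrow> 'v))"
proof -
  interpret V: vector_space scaleV by fact
  interpret F: vector_space formal_scale by (rule vector_space_formal_scale)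
  have ext: "formal_extend scaleV f p = (\<Sum>x\<in>A. scaleV (Poly_Mapping.lookup p x) (f x))"
    if "finite A" "Poly_Mapping.keys p \<subseteq> A" for A and p :: "'x \<Rightarrow>\<^sub>0 'k"
    unfolding formal_extend_def using that
    by (intro sum.mono_neutral_left) (auto simp: in_keys_iff)
  show ?thesis
  proof (intro Vector_Spaces.linear.intro module_hom.intro module_hom_axioms.intro)
    fix p q :: "'x \<Rightarrow>\<^sub>0 'k"
    let ?A = "Poly_Mapping.keys p \<union> Poly_Mapping.keys q"
    show "formal_extend scaleV f (p + q) = formal_extend scaleV f p + formal_extend scaleV f q"
      using keys_add[of p q]
      by (simp add: ext[of ?A] lookup_add V.scale_left_distrib sum.distrib)
  next
    fix c and p :: "'x \<Rightarrow>\<^sub>0 'k"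
    have "Poly_Mapping.keys (formal_scale c p) \<subseteq> Poly_Mapping.keys p"
      by (auto simp: in_keys_iff)
    then show "formal_extend scaleV f (formal_scale c p) = scaleV c (formal_extend scaleV f p)"
      by (simp add: ext[of "Poly_Mapping.keys p"] V.scale_sum_right)
  qed (unfold_locales)
qed

lemma linear_cong_tensor_class:
  assumes "Vector_Spaces.linear formal_scale scaleV g"
    and slots: "\<And>\<phi>. \<phi> \<in> slots \<Longrightarrow> Vector_Spaces.linear scale scaleV (\<lambda>a. g (formal_gen (\<phi> a)))"
    and "q \<in> tensor_class scale slots p"
  shows "g q = g p"
proof -
  interpret g: Vector_Spaces.linear formal_scale scaleV g by fact
  have "g r = 0" if "r \<in> multilinear_relations scale slots" for r
    using that unfolding multilinear_relations_def
  proof (rule g.vs1.span_induct)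
    show "g.vs1.subspace {r. g r = 0}" by (rule g.subspace_kernel)
  next
    fix r
    assume "r \<in> {formal_gen (\<phi> (a + b)) - formal_gen (\<phi> a) - formal_gen (\<phi> b) | \<phi> a b. \<phi> \<in> slots} \<union>
      {formal_gen (\<phi> (scale c a)) - formal_scale c (formal_gen (\<phi> a)) | \<phi> c a. \<phi> \<in> slots}"
    then show "g r = 0"
      by (auto simp: g.diff g.scale module_hom.add[OF Vector_Spaces.linear.axioms(3)[OF slots]]
          module_hom.scale[OF Vector_Spaces.linear.axioms(3)[OF slots]])
  qed
  then have "g (q - p) = 0" using assms(3) by (simp add: tensor_class_def)
  then show ?thesis by (simp add: g.diff)
qed

lemma tensor_rep_in_class: "tensor_rep (tensor_class scale slots p) \<in> tensor_class scale slots p"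
proof -
  interpret F: vector_space formal_scale by (rule vector_space_formal_scale)
  have "p \<in> tensor_class scale slots p"
    by (simp add: tensor_class_def multilinear_relations_def F.span_zero)
  then show ?thesis unfolding tensor_rep_def by (rule someI)
qed

lemma formal_extend_gen [simp]:
  "vector_space scaleV \<Longrightarrow> formal_extend scaleV f (formal_gen x) = f x"
  by (simp add: formal_extend_def vector_space_def)

lemma tensor_lift_class:
  assumes V: "vector_space scaleV"
    and slots: "\<And>\<phi>. \<phi> \<in> slots \<Longrightarrow> Vector_Spaces.linear scale scaleV (\<lambda>a. f (\<phi> a))"
  shows "tensor_lift scaleV f (tensor_class scale slots p) = formal_extend scaleV f p"
  unfolding tensor_lift_def using V slots
  by (intro linear_cong_tensor_class[OF linear_formal_extend[OF V] _ tensor_rep_in_class])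
     (simp add: linear_formal_extend)


section \<open>Hopf algebras over a field\<close>

locale unital_algebra = vector_space scale
  for scale :: "'k::field \<Rightarrow> 'h::ring_1 \<Rightarrow> 'h" +
  assumes scale_mult_left: "scale c a * b = scale c (a * b)"
    and scale_mult_right: "a * scale c b = scale c (a * b)"

locale coalgebra = vector_space scale
  for scale :: "'k::field \<Rightarrow> 'h::ab_group_add \<Rightarrow> 'h" +
  fixes comult :: "'h \<Rightarrow> ('h \<times> 'h \<Rightarrow>\<^sub>0 'k) set"
    and counit :: "'h \<Rightarrow> 'k"
  assumes comult_tensor: "comult a \<in> tensor_square scale"
    and comult_add: "comult (a + b) =
      tensor_class2 scale (tensor_rep (comult a) + tensor_rep (comult b))"
    and comult_scale: "comult (scale c a) =
      tensor_class2 scale (formal_scale c (tensor_rep (comult a)))"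
    and counit_linear: "Vector_Spaces.linear scale (*) counit"
    and coassoc:
      "tensor_class3 scale (tensor_lift formal_scale
         (\<lambda>(x, y). tensor_lift formal_scale (\<lambda>(u, v). formal_gen (u, v, y)) (comult x)) (comult a)) =
       tensor_class3 scale (tensor_lift formal_scale
         (\<lambda>(x, y). tensor_lift formal_scale (\<lambda>(u, v). formal_gen (x, u, v)) (comult y)) (comult a))"
    and counit_left: "tensor_lift scale (\<lambda>(x, y). scale (counit x) y) (comult a) = a"
    and counit_right: "tensor_lift scale (\<lambda>(x, y). scale (counit y) x) (comult a) = a"

locale bialgebra = unital_algebra scale + coalgebra scale comult counit
  for scale :: "'k::field \<Rightarrow> 'h::ring_1 \<Rightarrow> 'h"
    and comult :: "'h \<Rightarrow> ('h \<times> 'h \<Rightarrow>\<^sub>0 'k) set"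
    and counit :: "'h \<Rightarrow> 'k" +
  assumes comult_one: "comult 1 = tensor_class2 scale (formal_gen (1, 1))"
    and comult_mult: "comult (a * b) = tensor_class2 scale
      (tensor_lift formal_scale (\<lambda>(x, y). tensor_lift formal_scale
         (\<lambda>(u, v). formal_gen (x * u, y * v)) (comult b)) (comult a))"
    and counit_one: "counit 1 = 1"
    and counit_mult: "counit (a * b) = counit a * counit b"

locale hopf_algebra = bialgebra scale comult counit
  for scale :: "'k::field \<Rightarrow> 'h::ring_1 \<Rightarrow> 'h"
    and comult :: "'h \<Rightarrow> ('h \<times> 'h \<Rightarrow>\<^sub>0 'k) set"
    and counit :: "'h \<Rightarrow> 'k" +
  fixes antipode :: "'h \<Rightarrow> 'h"
  assumes antipode_linear: "Vector_Spaces.linear scale scale antipode"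
    and antipode_left:
      "tensor_lift scale (\<lambda>(x, y). antipode x * y) (comult a) = scale (counit a) 1"
    and antipode_right:
      "tensor_lift scale (\<lambda>(x, y). x * antipode y) (comult a) = scale (counit a) 1"


section \<open>The dual algebra and left integrals\<close>

definition dual :: "('k::field \<Rightarrow> 'h::ab_group_add \<Rightarrow> 'h) \<Rightarrow> ('h \<Rightarrow> 'k) set" where
  "dual scale = {\<alpha>. Vector_Spaces.linear scale (*) \<alpha>}"

definition dual_scale :: "'k::field \<Rightarrow> ('h \<Rightarrow> 'k) \<Rightarrow> ('h \<Rightarrow> 'k)" where
  "dual_scale c \<alpha> = (\<lambda>h. c * \<alpha> h)"

lemma vector_space_dual_scale: "vector_space (dual_scale :: 'k::field \<Rightarrow> ('h \<Rightarrow> 'k) \<Rightarrow> _)"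
  by unfold_locales (auto simp: dual_scale_def fun_eq_iff algebra_simps)

definition convolution ::
    "('h \<Rightarrow> ('h \<times> 'h \<Rightarrow>\<^sub>0 'k::field) set) \<Rightarrow> ('h \<Rightarrow> 'k) \<Rightarrow> ('h \<Rightarrow> 'k) \<Rightarrow> ('h \<Rightarrow> 'k)" where
  "convolution comult \<alpha> \<beta> = (\<lambda>h. tensor_lift (*) (\<lambda>(x, y). \<alpha> x * \<beta> y) (comult h))"

definition left_integrals ::
    "('k::field \<Rightarrow> 'h::ring_1 \<Rightarrow> 'h) \<Rightarrow> ('h \<Rightarrow> ('h \<times> 'h \<Rightarrow>\<^sub>0 'k) set) \<Rightarrow> ('h \<Rightarrow> 'k) set" where
  "left_integrals scale comult =
     {l \<in> dual scale. \<forall>\<alpha> \<in> dual scale. convolution comult \<alpha> l = dual_scale (\<alpha> 1) l}"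

end

(*
  Write h1 phi(h2) = phi(h) 1 for a left integral phi and psi(h1) h2 = psi(h) 1 for a right one.
  The argument is an algebraic version of Weil's uniqueness proof for Haar measure, arranged so that
  the antipode S need not be invertible. From b1 phi(b2 S(a)) = phi(b S(a1)) a2 one gets
  phi(b S(D a)) = psi(b) phi(S(a)) with D a = a1 psi(a2) independent of phi. Since
  phi(b S(h)) = 0 for all b forces h = 0 when phi is nonzero, D a is proportional to phi(S(a));
  applying the counit, psi is a multiple of phi o S. A nonzero psi exists: one of the functionals
  psi_u(a) = phi(u2 S(S(S(u1)) a)). Hence phi o S is nonzero for every nonzero phi, and any two left
  integrals are proportional after composition with S, hence proportional.
*)
theory Submission
  imports Defs
begin

section \<open>Linear functionals separate points\<close>

context vector_space
begin

text \<open>The coordinate along \<open>z\<close> with respect to a basis extending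
  \<open>{z}\<close> is such a functional; no finiteness of dimension enters.\<close>

lemma exists_linear_functional:
  assumes "z \<noteq> 0"
  shows "\<exists>\<omega>. Vector_Spaces.linear scale (*) \<omega> \<and> \<omega> z = 1"
proof -
  define B where "B = extend_basis {z}"
  have ind: "independent {z}"
    using assms by (simp add: dependent_single)
  have B: "independent B" "span B = UNIV" "z \<in> B"
    unfolding B_def using independent_extend_basis[OF ind] span_extend_basis[OF ind]
      extend_basis_superset[OF ind] by auto
  have "Vector_Spaces.linear scale (*) (\<lambda>v. representation B v z)"
  proof (intro Vector_Spaces.linear.intro module_hom.intro module_hom_axioms.intro)
    show "vector_space ((*) :: 'a \<Rightarrow> 'a \<Rightarrow> 'a)"
      by unfold_locales (auto simp: algebra_simps)
    show "module ((*) :: 'a \<Rightarrow> 'a \<Rightarrow> 'a)"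
      by unfold_locales (auto simp: algebra_simps)
  qed (use B in \<open>auto simp: representation_add representation_scale
      intro: vector_space_axioms module_axioms\<close>)
  moreover have "representation B z z = 1"
    using B by (simp add: representation_basis)
  ultimately show ?thesis by blast
qed

lemma eq_if_functionals_eq:
  assumes "\<And>\<omega>. Vector_Spaces.linear scale (*) \<omega> \<Longrightarrow> \<omega> z = \<omega> w"
  shows "z = w"
proof (rule ccontr)
  assume "z \<noteq> w"
  then obtain \<omega> where \<omega>: "Vector_Spaces.linear scale (*) \<omega>" "\<omega> (z - w) = 1"
    using exists_linear_functional[of "z - w"] by auto
  then show False
    using assms[OF \<omega>(1)] module_hom.diff[OF Vector_Spaces.linear.axioms(3)[OF \<omega>(1)]] by simp
qed

end

section \<open>Introduction and elimination rules for linear maps\<close>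

lemma linearI:
  assumes "vector_space s" "vector_space t"
    "\<And>x y. f (x + y) = f x + f y" "\<And>c x. f (s c x) = t c (f x)"
  shows "Vector_Spaces.linear s t f"
  using assms by (intro Vector_Spaces.linear.intro module_hom.intro module_hom_axioms.intro)
    (auto simp: module_iff_vector_space)

lemma linearD:
  assumes "Vector_Spaces.linear s t f"
  shows "vector_space s" "vector_space t"
    "f (x + y) = f x + f y" "f (s c x) = t c (f x)" "f (x - y) = f x - f y" "f 0 = 0"
    "f (sum g A) = (\<Sum>a\<in>A. f (g a))"
proof -
  interpret Vector_Spaces.linear s t f by fact
  show "vector_space s" "vector_space t"
    "f (x + y) = f x + f y" "f (s c x) = t c (f x)" "f (x - y) = f x - f y" "f 0 = 0"
    "f (sum g A) = (\<Sum>a\<in>A. f (g a))"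
    by (fact vs1.vector_space_axioms vs2.vector_space_axioms add scale diff zero sum)+
qed

lemma linear_compose_left:
  "Vector_Spaces.linear t u g \<Longrightarrow> Vector_Spaces.linear s t f \<Longrightarrow>
    Vector_Spaces.linear s u (\<lambda>x. g (f x))"
  using Vector_Spaces.linear_compose[of s t f u g] by (simp add: comp_def)

lemma linear_formal_extend_apply:
  assumes "Vector_Spaces.linear s t g"
  shows "g (formal_extend s F p) = formal_extend t (\<lambda>x. g (F x)) p"
  by (simp add: formal_extend_def linearD[OF assms])

section \<open>Sweedler sums\<close>

context coalgebra
begin

text \<open>
  The scalar of a summand is absorbed into the first leg, so that no scalar multiplication on the
  codomain of \<open>f\<close> enters.
\<close>
definition sweedler :: "('h \<Rightarrow> 'h \<Rightarrow> 'v::ab_group_add) \<Rightarrow> 'h \<Rightarrow> 'v" where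
  "sweedler f h = (\<Sum>(x, y)\<in>Poly_Mapping.keys (tensor_rep (comult h)).
     f (scale (Poly_Mapping.lookup (tensor_rep (comult h)) (x, y)) x) y)"

definition bilinear_map :: "('k \<Rightarrow> 'v \<Rightarrow> 'v) \<Rightarrow> ('h \<Rightarrow> 'h \<Rightarrow> 'v::ab_group_add) \<Rightarrow> bool" where
  "bilinear_map sV f \<longleftrightarrow>
     (\<forall>y. Vector_Spaces.linear scale sV (\<lambda>x. f x y)) \<and>
     (\<forall>x. Vector_Spaces.linear scale sV (\<lambda>y. f x y))"

lemma bilinear_mapI:
  assumes "\<And>y. Vector_Spaces.linear scale sV (\<lambda>x. f x y)"
    and "\<And>x. Vector_Spaces.linear scale sV (\<lambda>y. f x y)"
  shows "bilinear_map sV f"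
  using assms by (simp add: bilinear_map_def)

lemma sweedler_linear_apply:
  assumes "Vector_Spaces.linear s t g"
  shows "g (sweedler f h) = sweedler (\<lambda>x y. g (f x y)) h"
  by (simp add: sweedler_def linearD[OF assms] case_prod_unfold)

lemma sweedler_swap:
  "sweedler (\<lambda>x y. sweedler (\<lambda>u v. f x y u v) b) a =
   sweedler (\<lambda>u v. sweedler (\<lambda>x y. f x y u v) a) b"
  unfolding sweedler_def case_prod_unfold by (rule sum.swap)

lemma formal_extend_sweedler:
  assumes "\<And>y. Vector_Spaces.linear scale sV (\<lambda>x. f x y)"
  shows "formal_extend sV (\<lambda>(x, y). f x y) (tensor_rep (comult h)) = sweedler f h"
  by (simp add: formal_extend_def sweedler_def linearD(4)[OF assms] case_prod_unfold)

text \<open>Bilinearity makes the linear extension of \<open>f\<close> constant on cosets, so any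
  representative of \<open>comult h\<close> may replace the chosen one. The axioms for the coproduct
  of sums, multiples, 1 and products enter through this lemma.\<close>

lemma sweedler_class:
  assumes "bilinear_map sV f" "comult h = tensor_class2 scale p"
  shows "sweedler f h = formal_extend sV (\<lambda>(x, y). f x y) p"
proof -
  have f: "\<And>y. Vector_Spaces.linear scale sV (\<lambda>x. f x y)"
    "\<And>x. Vector_Spaces.linear scale sV (\<lambda>y. f x y)"
    using assms(1) by (auto simp: bilinear_map_def)
  have "tensor_lift sV (\<lambda>(x, y). f x y) (tensor_class2 scale p) =
      formal_extend sV (\<lambda>(x, y). f x y) p"
    by (rule tensor_lift_class) (use f in \<open>auto simp: slots2_def intro: linearD(2)[OF f(1)]\<close>)
  then show ?thesis
    by (simp add: tensor_lift_def assms(2)[symmetric] formal_extend_sweedler[OF f(1)])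
qed

lemma sweedler_add:
  assumes "bilinear_map sV f"
  shows "sweedler f (a + b) = sweedler f a + sweedler f b"
proof -
  have f: "\<And>y. Vector_Spaces.linear scale sV (\<lambda>x. f x y)"
    using assms by (auto simp: bilinear_map_def)
  show ?thesis
    using sweedler_class[OF assms comult_add]
    by (simp add: linearD(3)[OF linear_formal_extend[OF linearD(2)[OF f]]]
        formal_extend_sweedler[OF f])
qed

lemma sweedler_scale:
  assumes "bilinear_map sV f"
  shows "sweedler f (scale c a) = sV c (sweedler f a)"
proof -
  have f: "\<And>y. Vector_Spaces.linear scale sV (\<lambda>x. f x y)"
    using assms by (auto simp: bilinear_map_def)
  show ?thesis
    using sweedler_class[OF assms comult_scale]
    by (simp add: linearD(4)[OF linear_formal_extend[OF linearD(2)[OF f]]]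
        formal_extend_sweedler[OF f])
qed

text \<open>The parameter sits under the coproduct, so this is linearity of \<open>comult\<close>
  modulo the relations. In \<open>linear_sweedler_fun\<close> it sits in the summed map, where
  linearity is checked termwise.\<close>

lemma linear_sweedler:
  assumes "bilinear_map sV f" "Vector_Spaces.linear s scale g"
  shows "Vector_Spaces.linear s sV (\<lambda>z. sweedler f (g z))"
proof (rule linearI)
  show "vector_space sV" using assms(1) linearD(2) by (auto simp: bilinear_map_def)
qed (simp_all add: linearD[OF assms(2)] sweedler_add[OF assms(1)] sweedler_scale[OF assms(1)])

lemma linear_sweedler_fun:
  assumes "\<And>u v. Vector_Spaces.linear s sV (\<lambda>z. F z u v)"
  shows "Vector_Spaces.linear s sV (\<lambda>z. sweedler (F z) h)"
proof (rule linearI)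
  interpret V: vector_space sV using linearD(2)[OF assms] .
  show "vector_space s" "vector_space sV" using linearD(1,2)[OF assms] by auto
  show "sweedler (F (x + y)) h = sweedler (F x) h + sweedler (F y) h" for x y
    by (simp add: sweedler_def linearD(3)[OF assms] sum.distrib case_prod_unfold)
  show "sweedler (F (s c x)) h = sV c (sweedler (F x) h)" for c x
    by (simp add: sweedler_def linearD(4)[OF assms] V.scale_sum_right case_prod_unfold)
qed

text \<open>The linear extension of the trilinear \<open>f\<close> to formal combinations of triples
  is constant on cosets, hence agrees on the two sides of \<open>coassoc\<close>; evaluating it
  there gives the two nested sums.\<close>

lemma sweedler_coassoc:
  assumes 1: "\<And>y z. Vector_Spaces.linear scale sV (\<lambda>x. f x y z)"
    and 2: "\<And>x z. Vector_Spaces.linear scale sV (\<lambda>y. f x y z)"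
    and 3: "\<And>x y. Vector_Spaces.linear scale sV (\<lambda>z. f x y z)"
  shows "sweedler (\<lambda>x y. sweedler (\<lambda>u v. f u v y) x) a =
    sweedler (\<lambda>x y. sweedler (\<lambda>u v. f x u v) y) a"
proof -
  define g where "g = formal_extend sV (\<lambda>(x, y, z). f x y z)"
  have V: "vector_space sV" using linearD(2)[OF 1] .
  have g: "Vector_Spaces.linear formal_scale sV g"
    unfolding g_def by (rule linear_formal_extend[OF V])
  have gen: "g (formal_gen (x, y, z)) = f x y z" for x y z
    by (simp add: g_def V)
  have slots: "Vector_Spaces.linear scale sV (\<lambda>a. g (formal_gen (\<phi> a)))" if "\<phi> \<in> slots3" for \<phi>
    using that 1 2 3 by (auto simp: slots3_def gen)
  let ?P = "tensor_lift formal_scale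
     (\<lambda>(x, y). tensor_lift formal_scale (\<lambda>(u, v). formal_gen (u, v, y)) (comult x)) (comult a)"
  let ?Q = "tensor_lift formal_scale
     (\<lambda>(x, y). tensor_lift formal_scale (\<lambda>(u, v). formal_gen (x, u, v)) (comult y)) (comult a)"
  interpret F: vector_space formal_scale by (rule vector_space_formal_scale)
  \<comment> \<open>Equality of cosets becomes membership: \<open>?P\<close> lies in its own coset,
    which is that of \<open>?Q\<close>.\<close>
  have "?P \<in> tensor_class3 scale ?P"
    by (simp add: tensor_class_def multilinear_relations_def F.span_zero)
  then have "?P \<in> tensor_class3 scale ?Q" by (simp only: coassoc)
  then have "g ?P = g ?Q"
    by (rule linear_cong_tensor_class[OF g, rotated]) (rule slots)
  moreover have "g ?P = sweedler (\<lambda>x y. sweedler (\<lambda>u v. f u v y) x) a"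
  proof -
    have l: "Vector_Spaces.linear scale sV (\<lambda>x. sweedler (\<lambda>u v. f u v y) x)" for y
      by (rule linear_sweedler) (auto intro!: bilinear_mapI 1 2 linear_ident)
    have "g (tensor_lift formal_scale (\<lambda>(u, v). formal_gen (u, v, y)) (comult x)) =
        sweedler (\<lambda>u v. f u v y) x" for x y
      unfolding tensor_lift_def linear_formal_extend_apply[OF g] case_prod_unfold gen
      using formal_extend_sweedler[of sV "\<lambda>u v. f u v y" x] 1 by (simp add: case_prod_unfold)
    then show ?thesis
      unfolding formal_extend_sweedler[OF l, symmetric]
      by (simp add: tensor_lift_def[of _ _ "comult a"] linear_formal_extend_apply[OF g]
          case_prod_unfold)
  qed
  moreover have "g ?Q = sweedler (\<lambda>x y. sweedler (\<lambda>u v. f x u v) y) a"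
  proof -
    have l: "Vector_Spaces.linear scale sV (\<lambda>x. sweedler (\<lambda>u v. f x u v) y)" for y
      by (rule linear_sweedler_fun) (rule 1)
    have "g (tensor_lift formal_scale (\<lambda>(u, v). formal_gen (x, u, v)) (comult y)) =
        sweedler (\<lambda>u v. f x u v) y" for x y
      unfolding tensor_lift_def linear_formal_extend_apply[OF g] case_prod_unfold gen
      using formal_extend_sweedler[of sV "\<lambda>u v. f x u v" y] 2 by (simp add: case_prod_unfold)
    then show ?thesis
      unfolding formal_extend_sweedler[OF l, symmetric]
      by (simp add: tensor_lift_def[of _ _ "comult a"] linear_formal_extend_apply[OF g]
          case_prod_unfold)
  qed
  ultimately show ?thesis by simp
qed

lemma sweedler_counit_left:
  assumes "Vector_Spaces.linear scale sV g"
  shows "sweedler (\<lambda>x y. sV (counit x) (g y)) a = g a"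
proof -
  have "sweedler (\<lambda>x y. scale (counit x) y) a = a"
    using counit_left[of a] unfolding tensor_lift_def
    by (subst (asm) formal_extend_sweedler)
      (auto intro!: linearI simp: linearD[OF counit_linear] algebra_simps vector_space_axioms)
  then have "g a = g (sweedler (\<lambda>x y. scale (counit x) y) a)" by simp
  also have "\<dots> = sweedler (\<lambda>x y. sV (counit x) (g y)) a"
    by (simp add: sweedler_linear_apply[OF assms] linearD[OF assms])
  finally show ?thesis by simp
qed

lemma sweedler_counit_right:
  assumes "Vector_Spaces.linear scale sV g"
  shows "sweedler (\<lambda>x y. sV (counit y) (g x)) a = g a"
proof -
  have "sweedler (\<lambda>x y. scale (counit y) x) a = a"
    using counit_right[of a] unfolding tensor_lift_def
    by (subst (asm) formal_extend_sweedler)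
      (auto intro!: linearI simp: linearD[OF counit_linear] algebra_simps vector_space_axioms)
  then have "g a = g (sweedler (\<lambda>x y. scale (counit y) x) a)" by simp
  also have "\<dots> = sweedler (\<lambda>x y. sV (counit y) (g x)) a"
    by (simp add: sweedler_linear_apply[OF assms] linearD[OF assms])
  finally show ?thesis by simp
qed

text \<open>
  If \<open>h\<^sub>1 \<omega>(h\<^sub>2)\<close> lies in a set \<open>N\<close> for every functional \<open>\<omega>\<close>, then morally
  \<open>\<Delta> h \<in> N \<otimes> H\<close>; here \<open>N\<close> is the left kernel of \<open>t\<close>.
\<close>
lemma sweedler_eq_0:
  assumes t: "bilinear_map sV t"
    and zero: "\<And>\<omega> y. Vector_Spaces.linear scale (*) \<omega> \<Longrightarrow>
      t (sweedler (\<lambda>x1 x2. scale (\<omega> x2) x1) h) y = 0"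
  shows "sweedler t h = 0"
proof -
  define B where "B = extend_basis {}"
  have B: "independent B" "span B = UNIV"
    unfolding B_def using independent_extend_basis span_extend_basis independent_empty by auto
  define \<rho> where "\<rho> = representation B"
  have t1: "\<And>y. Vector_Spaces.linear scale sV (\<lambda>x. t x y)"
    and t2: "\<And>x. Vector_Spaces.linear scale sV (\<lambda>y. t x y)"
    using t by (auto simp: bilinear_map_def)
  have \<rho>: "Vector_Spaces.linear scale (*) (\<lambda>y. \<rho> y b)" for b
    unfolding \<rho>_def by (rule linearI)
      (use B in \<open>auto simp: representation_add representation_scale vector_space_axioms
        intro: linearD(2)[OF counit_linear]\<close>)
  define K where "K = Poly_Mapping.keys (tensor_rep (comult h))"
  \<comment> \<open>The basis vectors occurring in the second legs of the chosen representative; all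
    these legs are expanded over this one finite set.\<close>
  define W where "W = (\<Union>(x, y)\<in>K. {b. \<rho> y b \<noteq> 0})"
  have W: "finite W"
    by (auto simp: W_def K_def \<rho>_def finite_representation)
  define X where "X x y = scale (Poly_Mapping.lookup (tensor_rep (comult h)) (x, y)) x" for x y
  have expand: "t (X x y) y = (\<Sum>b\<in>W. t (scale (\<rho> y b) (X x y)) b)" if "(x, y) \<in> K" for x y
  proof -
    have "y = (\<Sum>b\<in>{b. \<rho> y b \<noteq> 0}. scale (\<rho> y b) b)"
      using sum_nonzero_representation_eq[OF B(1)] B(2) by (simp add: \<rho>_def)
    also have "\<dots> = (\<Sum>b\<in>W. scale (\<rho> y b) b)"
      using that W by (intro sum.mono_neutral_left) (auto simp: W_def)
    finally have "t (X x y) y = t (X x y) (\<Sum>b\<in>W. scale (\<rho> y b) b)" by simp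
    also have "\<dots> = (\<Sum>b\<in>W. t (scale (\<rho> y b) (X x y)) b)"
      by (simp add: linearD[OF t2] linearD(4)[OF t1])
    finally show ?thesis .
  qed
  have "sweedler t h = (\<Sum>(x, y)\<in>K. \<Sum>b\<in>W. t (scale (\<rho> y b) (X x y)) b)"
    unfolding sweedler_def K_def[symmetric] X_def[symmetric]
    by (rule sum.cong) (auto simp: expand)
  also have "\<dots> = (\<Sum>b\<in>W. \<Sum>(x, y)\<in>K. t (scale (\<rho> y b) (X x y)) b)"
    unfolding case_prod_unfold by (rule sum.swap)
  \<comment> \<open>Linearity in the first slot collects the coefficient of \<open>b\<close> into h1
    \<rho>(h2), where \<rho> is the coordinate along \<open>b\<close>; the hypothesis kills each
    such term.\<close>
  also have "\<dots> = (\<Sum>b\<in>W. t (sweedler (\<lambda>x1 x2. scale (\<rho> x2 b) x1) h) b)"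
    by (simp add: sweedler_def K_def X_def linearD(7)[OF t1] case_prod_unfold)
  also have "\<dots> = 0" by (simp add: zero[OF \<rho>])
  finally show ?thesis .
qed

end

section \<open>The antipode is an antihomomorphism of algebras and coalgebras\<close>

context hopf_algebra
begin

lemma vector_space_mult: "vector_space ((*) :: 'k \<Rightarrow> 'k \<Rightarrow> 'k)"
  using linearD(2)[OF counit_linear] .

lemma linear_id: "Vector_Spaces.linear scale scale (\<lambda>x. x)"
  by (rule linear_ident)

lemma linear_mult_left:
  "Vector_Spaces.linear scale scale g \<Longrightarrow> Vector_Spaces.linear scale scale (\<lambda>x. g x * a)"
  by (rule linearI) (simp_all add: linearD vector_space_axioms algebra_simps scale_mult_left)

lemma linear_mult_right:
  "Vector_Spaces.linear scale scale g \<Longrightarrow> Vector_Spaces.linear scale scale (\<lambda>x. a * g x)"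
  by (rule linearI) (simp_all add: linearD vector_space_axioms algebra_simps scale_mult_right)

lemma linear_scale_left:
  "Vector_Spaces.linear scale (*) g \<Longrightarrow> Vector_Spaces.linear scale scale (\<lambda>x. scale (g x) a)"
  by (rule linearI) (simp_all add: linearD vector_space_axioms scale_left_distrib)

lemma linear_scale_right:
  "Vector_Spaces.linear scale scale g \<Longrightarrow> Vector_Spaces.linear scale scale (\<lambda>x. scale c (g x))"
  by (rule linearI) (simp_all add: linearD vector_space_axioms scale_right_distrib mult.commute)

lemma linear_scale_field: "Vector_Spaces.linear (*) scale (\<lambda>c. scale c a)"
  by (rule linearI) (simp_all add: vector_space_mult vector_space_axioms scale_left_distrib)

lemma linear_times_left:
  "Vector_Spaces.linear scale (*) g \<Longrightarrow> Vector_Spaces.linear scale (*) (\<lambda>x. g x * a)"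
  by (rule linearI) (simp_all add: linearD vector_space_axioms vector_space_mult algebra_simps)

lemma linear_times_right:
  "Vector_Spaces.linear scale (*) g \<Longrightarrow> Vector_Spaces.linear scale (*) (\<lambda>x. a * g x)"
  by (rule linearI) (simp_all add: linearD vector_space_axioms vector_space_mult algebra_simps)

lemmas linear_intros = linear_id linear_mult_left linear_mult_right linear_scale_left
  linear_scale_right linear_times_left linear_times_right linear_sweedler_fun linear_sweedler
  bilinear_mapI linear_compose_left[OF antipode_linear] linear_compose_left[OF counit_linear]

lemmas counit_simps = linearD(3-6)[OF counit_linear]

section \<open>Antipode axioms, unit and product in terms of Sweedler sums\<close>

lemma sweedler_antipode_left: "sweedler (\<lambda>x y. antipode x * y) a = scale (counit a) 1"
  using antipode_left[of a] unfolding tensor_lift_def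
  by (subst (asm) formal_extend_sweedler[where sV = scale]) (intro linear_intros | assumption)+

lemma sweedler_antipode_right: "sweedler (\<lambda>x y. x * antipode y) a = scale (counit a) 1"
  using antipode_right[of a] unfolding tensor_lift_def
  by (subst (asm) formal_extend_sweedler[where sV = scale]) (intro linear_intros | assumption)+

lemma sweedler_antipode_left_apply:
  assumes "Vector_Spaces.linear scale sV g"
  shows "sweedler (\<lambda>x y. g (antipode x * y)) a = sV (counit a) (g 1)"
  by (simp add: sweedler_linear_apply[OF assms, symmetric] sweedler_antipode_left linearD[OF assms])

lemma sweedler_antipode_right_apply:
  assumes "Vector_Spaces.linear scale sV g"
  shows "sweedler (\<lambda>x y. g (x * antipode y)) a = sV (counit a) (g 1)"
  by (simp add: sweedler_linear_apply[OF assms, symmetric] sweedler_antipode_right linearD[OF assms])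

lemma sweedler_one:
  assumes "bilinear_map sV f"
  shows "sweedler f 1 = f 1 1"
proof -
  have "vector_space sV" using assms linearD(2) by (auto simp: bilinear_map_def)
  then show ?thesis by (simp add: sweedler_class[OF assms comult_one])
qed

text \<open>The antipode axiom is read off at 1, whose coproduct is 1 \<otimes> 1 and whose counit
  is 1.\<close>

lemma antipode_one: "antipode 1 = 1"
proof -
  have "sweedler (\<lambda>x y. antipode x * y) 1 = antipode 1 * 1"
    by (rule sweedler_one[where sV = scale]) (intro linear_intros)
  then show ?thesis by (simp add: sweedler_antipode_left counit_one)
qed

lemma sweedler_mult:
  assumes f: "bilinear_map sV f"
  shows "sweedler f (a * b) = sweedler (\<lambda>x y. sweedler (\<lambda>u v. f (x * u) (y * v)) b) a"
proof -
  have f1: "\<And>y. Vector_Spaces.linear scale sV (\<lambda>x. f x y)"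
    and f2: "\<And>x. Vector_Spaces.linear scale sV (\<lambda>y. f x y)"
    using f by (auto simp: bilinear_map_def)
  note V = linearD(2)[OF f1]
  define g where "g = formal_extend sV (\<lambda>(x, y). f x y)"
  have g: "Vector_Spaces.linear formal_scale sV g"
    unfolding g_def by (rule linear_formal_extend[OF V])
  have gen: "g (formal_gen (x, y)) = f x y" for x y
    by (simp add: g_def V)
  have inner: "g (tensor_lift formal_scale (\<lambda>(u, v). formal_gen (x * u, y * v)) (comult b)) =
      sweedler (\<lambda>u v. f (x * u) (y * v)) b" for x y
    unfolding tensor_lift_def linear_formal_extend_apply[OF g] case_prod_unfold gen
    using formal_extend_sweedler[of sV "\<lambda>u v. f (x * u) (y * v)" b]
    by (simp add: case_prod_unfold linear_compose_left[OF f1] linear_intros)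
  have l: "Vector_Spaces.linear scale sV (\<lambda>x. sweedler (\<lambda>u v. f (x * u) (y * v)) b)" for y
    by (intro linear_intros linear_compose_left[OF f1])
  show ?thesis
    unfolding sweedler_class[OF f comult_mult] formal_extend_sweedler[OF l, symmetric]
    by (simp add: tensor_lift_def[of _ _ "comult a"] linear_formal_extend_apply[OF g]
        case_prod_unfold inner[unfolded case_prod_unfold] flip: g_def[unfolded case_prod_unfold])
qed

section \<open>The antipode reverses products\<close>

text \<open>The expression S(a1 b1) a2 b2 S(b3) is contracted in two ways: b2 S(b3) collapses to a
  counit, leaving S(a1 b) a2, while S(a1 b1) a2 b2 is the antipode axiom for a product and leaves
  \<epsilon>(a) S(b).\<close>

lemma sweedler_antipode_mult:
  "sweedler (\<lambda>a1 a2. antipode (a1 * b) * a2) a = scale (counit a) (antipode b)"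
proof -
  let ?S = antipode
  have eps: "scale (counit a) (scale (counit x) y) =
      sweedler (\<lambda>a1 a2. sweedler (\<lambda>b1 b2. ?S (a1 * b1) * (a2 * b2) * y) x) a" for x y
  proof -
    have "scale (counit a) (scale (counit x) y) = sweedler (\<lambda>u v. ?S u * v * y) (a * x)"
      by (simp add: sweedler_antipode_left_apply[where g = "\<lambda>z. z * y" and sV = scale]
          linear_intros counit_mult)
    also have "\<dots> = sweedler (\<lambda>a1 a2. sweedler (\<lambda>b1 b2. ?S (a1 * b1) * (a2 * b2) * y) x) a"
      by (rule sweedler_mult[where sV = scale]) (intro linear_intros)
    finally show ?thesis .
  qed
  have inner: "sweedler (\<lambda>b' b3. sweedler (\<lambda>b1 b2. ?S (a1 * b1) * (a2 * b2) * ?S b3) b') b =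
      ?S (a1 * b) * a2" for a1 a2
  proof -
    have "sweedler (\<lambda>b' b3. sweedler (\<lambda>b1 b2. ?S (a1 * b1) * (a2 * b2) * ?S b3) b') b =
        sweedler (\<lambda>b1 b'. sweedler (\<lambda>b2 b3. ?S (a1 * b1) * (a2 * b2) * ?S b3) b') b"
      by (rule sweedler_coassoc[where sV = scale]) (intro linear_intros)+
    also have "\<dots> = sweedler (\<lambda>b1 b'. scale (counit b') (?S (a1 * b1) * a2)) b"
      using sweedler_antipode_right_apply[where g = "\<lambda>z. ?S (a1 * b1) * (a2 * z)" and sV = scale
          for b1] by (simp add: linear_intros mult.assoc)
    also have "\<dots> = ?S (a1 * b) * a2"
      by (rule sweedler_counit_right) (intro linear_intros)
    finally show ?thesis .
  qed
  have "scale (counit a) (?S b) = sweedler (\<lambda>b' b3. scale (counit b') (scale (counit a) (?S b3))) b"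
    by (rule sweedler_counit_left[symmetric]) (intro linear_intros)
  also have "\<dots> = sweedler (\<lambda>b' b3. scale (counit a) (scale (counit b') (?S b3))) b"
    by (simp add: mult.commute)
  also have "\<dots> = sweedler (\<lambda>a1 a2. sweedler (\<lambda>b' b3.
      sweedler (\<lambda>b1 b2. ?S (a1 * b1) * (a2 * b2) * ?S b3) b') b) a"
    unfolding eps by (rule sweedler_swap)
  also have "\<dots> = sweedler (\<lambda>a1 a2. ?S (a1 * b) * a2) a"
    by (simp only: inner)
  finally show ?thesis by simp
qed

text \<open>Inserting a2 S(a3) gives S(ab) = S(a1 b) a2 S(a3), and
  \<open>sweedler_antipode_mult\<close> contracts the first two factors to S(b).\<close>

lemma antipode_mult: "antipode (a * b) = antipode b * antipode a"
proof -
  let ?S = antipode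
  have "?S (a * b) = sweedler (\<lambda>a1 a'. scale (counit a') (?S (a1 * b))) a"
    by (rule sweedler_counit_right[symmetric]) (intro linear_intros)
  also have "\<dots> = sweedler (\<lambda>a1 a'. sweedler (\<lambda>a2 a3. ?S (a1 * b) * (a2 * ?S a3)) a') a"
    by (subst sweedler_antipode_right_apply[where sV = scale]) (simp_all add: linear_intros)
  also have "\<dots> = sweedler (\<lambda>a' a3. sweedler (\<lambda>a1 a2. ?S (a1 * b) * (a2 * ?S a3)) a') a"
    by (rule sweedler_coassoc[symmetric, where sV = scale]) (intro linear_intros)+
  also have "\<dots> = sweedler (\<lambda>a' a3. sweedler (\<lambda>a1 a2. ?S (a1 * b) * a2) a' * ?S a3) a"
    by (simp add: sweedler_linear_apply[OF linear_mult_left[OF linear_id]] mult.assoc)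
  also have "\<dots> = sweedler (\<lambda>a' a3. scale (counit a') (?S b * ?S a3)) a"
    by (simp add: sweedler_antipode_mult scale_mult_left)
  also have "\<dots> = ?S b * ?S a"
    by (rule sweedler_counit_left) (intro linear_intros)
  finally show ?thesis .
qed

section \<open>The antipode reverses coproducts\<close>

text \<open>With \<open>f\<close> as a test map for tensors, this is \<Delta>(S(a1)) (a2 \<otimes>
  1) = 1 \<otimes> S(a). The right side equals \<Delta>(S(a1) a2) (1 \<otimes> S(a3)) =
  \<Delta>(S(a1)) (a2 \<otimes> a3 S(a4)), where a3 S(a4) contracts.\<close>

lemma sweedler_of_antipode_aux:
  assumes f: "bilinear_map sV f"
  shows "sweedler (\<lambda>a1 a2. sweedler (\<lambda>p q. f (p * a2) q) (antipode a1)) a = f 1 (antipode a)"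
proof -
  let ?S = antipode
  have f1: "\<And>y. Vector_Spaces.linear scale sV (\<lambda>x. f x y)"
    and f2: "\<And>x. Vector_Spaces.linear scale sV (\<lambda>y. f x y)"
    using f by (auto simp: bilinear_map_def)
  note li = linear_intros linear_compose_left[OF f1] linear_compose_left[OF f2]
  have eps: "sV (counit x) (f 1 w) = sweedler (\<lambda>a1 a''. sweedler (\<lambda>p q.
      sweedler (\<lambda>a2 a3. f (p * a2) (q * a3 * w)) a'') (?S a1)) x" for x w
  proof -
    have b: "bilinear_map sV (\<lambda>p q. f p (q * w))" by (intro li)
    have "sweedler (\<lambda>a1 a''. sweedler (\<lambda>p q. f p (q * w)) (?S a1 * a'')) x =
        sV (counit x) (sweedler (\<lambda>p q. f p (q * w)) 1)"
      by (rule sweedler_antipode_left_apply) (intro li)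
    then show ?thesis by (simp add: sweedler_mult[OF b] sweedler_one[OF b])
  qed
  have inner: "sweedler (\<lambda>x a4. sweedler (\<lambda>a2 a3. f (p * a2) (q * a3 * ?S a4)) x) y =
      f (p * y) q" for p q y
  proof -
    have "sweedler (\<lambda>x a4. sweedler (\<lambda>a2 a3. f (p * a2) (q * a3 * ?S a4)) x) y =
        sweedler (\<lambda>a2 x. sweedler (\<lambda>a3 a4. f (p * a2) (q * a3 * ?S a4)) x) y"
      by (rule sweedler_coassoc[where sV = sV]) (intro li)+
    also have "\<dots> = sweedler (\<lambda>a2 x. sV (counit x) (f (p * a2) q)) y"
      using sweedler_antipode_right_apply[where g = "\<lambda>z. f (p * a2) (q * z)" and sV = sV for a2]
      by (simp add: li mult.assoc)
    also have "\<dots> = f (p * y) q"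
      by (rule sweedler_counit_right) (intro li)
    finally show ?thesis .
  qed
  have "f 1 (?S a) = sweedler (\<lambda>x a4. sV (counit x) (f 1 (?S a4))) a"
    by (rule sweedler_counit_left[symmetric]) (intro li)
  also have "\<dots> = sweedler (\<lambda>x a4. sweedler (\<lambda>a1 a''. sweedler (\<lambda>p q.
      sweedler (\<lambda>a2 a3. f (p * a2) (q * a3 * ?S a4)) a'') (?S a1)) x) a"
    by (simp only: eps)
  also have "\<dots> = sweedler (\<lambda>a1 y. sweedler (\<lambda>a'' a4. sweedler (\<lambda>p q.
      sweedler (\<lambda>a2 a3. f (p * a2) (q * a3 * ?S a4)) a'') (?S a1)) y) a"
    by (rule sweedler_coassoc[where sV = sV]) (intro li)+
  also have "\<dots> = sweedler (\<lambda>a1 y. sweedler (\<lambda>p q. sweedler (\<lambda>a'' a4.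
      sweedler (\<lambda>a2 a3. f (p * a2) (q * a3 * ?S a4)) a'') y) (?S a1)) a"
    by (subst sweedler_swap) (rule refl)
  also have "\<dots> = sweedler (\<lambda>a1 y. sweedler (\<lambda>p q. f (p * y) q) (?S a1)) a"
    by (simp only: inner)
  finally show ?thesis by simp
qed

text \<open>Inserting a2 S(a3) in the first leg gives \<Delta>(S(a)) = \<Delta>(S(a1)) (a2 S(a3)
  \<otimes> 1), to which the auxiliary identity applies.\<close>

lemma sweedler_of_antipode:
  assumes f: "bilinear_map sV f"
  shows "sweedler f (antipode a) = sweedler (\<lambda>x y. f (antipode y) (antipode x)) a"
proof -
  let ?S = antipode
  have f1: "\<And>y. Vector_Spaces.linear scale sV (\<lambda>x. f x y)"
    and f2: "\<And>x. Vector_Spaces.linear scale sV (\<lambda>y. f x y)"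
    using f by (auto simp: bilinear_map_def)
  note li = linear_intros linear_compose_left[OF f1] linear_compose_left[OF f2]
  have eps: "sweedler (\<lambda>a2 a3. sweedler (\<lambda>p q. f (p * (a2 * ?S a3)) q) (?S a1)) x =
      sV (counit x) (sweedler f (?S a1))" for a1 x
    using sweedler_antipode_right_apply[where sV = sV and
        g = "\<lambda>z. sweedler (\<lambda>p q. f (p * z) q) (?S a1)"]
    by (simp add: li)
  have "sweedler f (?S a) = sweedler (\<lambda>a1 x. sV (counit x) (sweedler f (?S a1))) a"
    by (rule sweedler_counit_right[symmetric]) (intro li)
  also have "\<dots> = sweedler (\<lambda>a1 x. sweedler (\<lambda>a2 a3.
      sweedler (\<lambda>p q. f (p * (a2 * ?S a3)) q) (?S a1)) x) a"
    by (simp only: eps)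
  also have "\<dots> = sweedler (\<lambda>x a3. sweedler (\<lambda>a1 a2.
      sweedler (\<lambda>p q. f (p * (a2 * ?S a3)) q) (?S a1)) x) a"
    by (rule sweedler_coassoc[symmetric, where sV = sV]) (intro li)+
  also have "\<dots> = sweedler (\<lambda>x a3. f (?S a3) (?S x)) a"
  proof -
    \<comment> \<open>For each \<open>a3\<close>, the auxiliary identity is used with the first leg
      of \<open>f\<close> multiplied on the right by S(a3).\<close>
    have "bilinear_map sV (\<lambda>p q. f (p * ?S a3) q)" for a3 by (intro li)
    from sweedler_of_antipode_aux[OF this] show ?thesis by (simp add: mult.assoc)
  qed
  finally show ?thesis .
qed

lemma sweedler_of_antipode_antipode:
  assumes f: "bilinear_map sV f"
  shows "sweedler f (antipode (antipode a)) =
    sweedler (\<lambda>x y. f (antipode (antipode x)) (antipode (antipode y))) a"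
proof -
  have f1: "\<And>y. Vector_Spaces.linear scale sV (\<lambda>x. f x y)"
    and f2: "\<And>x. Vector_Spaces.linear scale sV (\<lambda>y. f x y)"
    using f by (auto simp: bilinear_map_def)
  have "bilinear_map sV (\<lambda>x y. f (antipode y) (antipode x))"
    by (intro linear_intros linear_compose_left[OF f1] linear_compose_left[OF f2])
  then show ?thesis
    by (simp add: sweedler_of_antipode[OF f] sweedler_of_antipode)
qed

end

section \<open>Left and right integrals\<close>

context hopf_algebra
begin

text \<open>An equation with values in H, instead of one scalar equation per functional, can be
  multiplied and contracted inside Sweedler sums.\<close>

definition left_integral :: "('h \<Rightarrow> 'k) \<Rightarrow> bool" where
  "left_integral \<phi> \<longleftrightarrow> Vector_Spaces.linear scale (*) \<phi> \<and>
     (\<forall>h. sweedler (\<lambda>x y. scale (\<phi> y) x) h = scale (\<phi> h) 1)"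

definition right_integral :: "('h \<Rightarrow> 'k) \<Rightarrow> bool" where
  "right_integral \<psi> \<longleftrightarrow> Vector_Spaces.linear scale (*) \<psi> \<and>
     (\<forall>h. sweedler (\<lambda>x y. scale (\<psi> x) y) h = scale (\<psi> h) 1)"

text \<open>The convolution of \<alpha> with \<phi> at \<open>h\<close> is \<alpha>(h1 \<phi>(h2)).
  Asking for the integral condition for all \<alpha> thus tests h1 \<phi>(h2) = \<phi>(h) 1 against
  all functionals, which separate points.\<close>

lemma left_integrals_eq: "left_integrals scale comult = {\<phi>. left_integral \<phi>}"
proof -
  have conv: "convolution comult \<alpha> \<phi> h = \<alpha> (sweedler (\<lambda>x y. scale (\<phi> y) x) h)"
    if \<alpha>: "Vector_Spaces.linear scale (*) \<alpha>" for \<alpha> \<phi> h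
  proof -
    have "convolution comult \<alpha> \<phi> h = sweedler (\<lambda>x y. \<alpha> x * \<phi> y) h"
      unfolding convolution_def tensor_lift_def
      by (rule formal_extend_sweedler) (intro linear_intros \<alpha>)
    then show ?thesis
      by (simp add: sweedler_linear_apply[OF \<alpha>] linearD[OF \<alpha>] mult.commute)
  qed
  have "left_integral \<phi> \<longleftrightarrow> Vector_Spaces.linear scale (*) \<phi> \<and>
      (\<forall>\<alpha>. Vector_Spaces.linear scale (*) \<alpha> \<longrightarrow> convolution comult \<alpha> \<phi> = dual_scale (\<alpha> 1) \<phi>)" for \<phi>
  proof -
    have "sweedler (\<lambda>x y. scale (\<phi> y) x) h = scale (\<phi> h) 1 \<longleftrightarrow>
        (\<forall>\<alpha>. Vector_Spaces.linear scale (*) \<alpha> \<longrightarrow> convolution comult \<alpha> \<phi> h = \<alpha> 1 * \<phi> h)" for h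
      using eq_if_functionals_eq[of "sweedler (\<lambda>x y. scale (\<phi> y) x) h" "scale (\<phi> h) 1"]
      by (auto simp: conv linearD mult.commute)
    then show ?thesis
      by (auto simp: left_integral_def dual_scale_def fun_eq_iff)
  qed
  then show ?thesis by (auto simp: left_integrals_def dual_def)
qed

section \<open>Strong invariance and nondegeneracy of a left integral\<close>

text \<open>Invariance at b S(x) reads \<phi>(b S(x)) 1 = b1 S(x2) \<phi>(b2 S(x1)), since S
  reverses coproducts. Taking x = a1 and multiplying on the right by a2 produces S(a2) a3, which
  contracts.\<close>

lemma left_integral_antipode:
  assumes "left_integral \<phi>"
  shows "sweedler (\<lambda>b1 b2. scale (\<phi> (b2 * antipode a)) b1) b =
    sweedler (\<lambda>a1 a2. scale (\<phi> (b * antipode a1)) a2) a"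
proof -
  let ?S = antipode
  have \<phi>: "Vector_Spaces.linear scale (*) \<phi>"
    and inv: "\<And>h. sweedler (\<lambda>x y. scale (\<phi> y) x) h = scale (\<phi> h) 1"
    using assms by (auto simp: left_integral_def)
  note li = linear_intros linear_compose_left[OF \<phi>]
  have expand: "scale (\<phi> (b * ?S x)) z = sweedler (\<lambda>b1 b2. sweedler (\<lambda>x1 x2.
      scale (\<phi> (b2 * ?S x1)) (b1 * ?S x2 * z)) x) b" for x z
  proof -
    have b1: "bilinear_map scale (\<lambda>x y. scale (\<phi> y) (x * z))" by (intro li)
    have b2: "bilinear_map scale (\<lambda>u v. scale (\<phi> (b2 * v)) (b1 * u * z))" for b1 b2 by (intro li)
    have "scale (\<phi> (b * ?S x)) z = scale (\<phi> (b * ?S x)) 1 * z"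
      by (simp add: scale_mult_left)
    also have "\<dots> = sweedler (\<lambda>x y. scale (\<phi> y) x * z) (b * ?S x)"
      unfolding inv[symmetric] by (rule sweedler_linear_apply[where s = scale and t = scale]) (intro li)
    also have "\<dots> = sweedler (\<lambda>x y. scale (\<phi> y) (x * z)) (b * ?S x)"
      by (simp add: scale_mult_left)
    also have "\<dots> = sweedler (\<lambda>b1 b2. sweedler (\<lambda>x1 x2.
        scale (\<phi> (b2 * ?S x1)) (b1 * ?S x2 * z)) x) b"
      by (simp add: sweedler_mult[OF b1] sweedler_of_antipode[OF b2])
    finally show ?thesis .
  qed
  have "sweedler (\<lambda>a' a3. scale (\<phi> (b * ?S a')) a3) a =
      sweedler (\<lambda>b1 b2. sweedler (\<lambda>a' a3. sweedler (\<lambda>x1 x2.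
        scale (\<phi> (b2 * ?S x1)) (b1 * ?S x2 * a3)) a') a) b"
    unfolding expand by (rule sweedler_swap)
  also have "\<dots> = sweedler (\<lambda>b1 b2. scale (\<phi> (b2 * ?S a)) b1) b"
  proof -
    have "sweedler (\<lambda>a' a3. sweedler (\<lambda>x1 x2.
        scale (\<phi> (b2 * ?S x1)) (b1 * ?S x2 * a3)) a') a = scale (\<phi> (b2 * ?S a)) b1" for b1 b2
    proof -
      have "sweedler (\<lambda>a' a3. sweedler (\<lambda>x1 x2.
            scale (\<phi> (b2 * ?S x1)) (b1 * ?S x2 * a3)) a') a =
          sweedler (\<lambda>x1 a'. sweedler (\<lambda>x2 a3.
            scale (\<phi> (b2 * ?S x1)) (b1 * ?S x2 * a3)) a') a"
        by (rule sweedler_coassoc[where sV = scale]) (intro li)+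
      also have "\<dots> = sweedler (\<lambda>x1 a'. scale (counit a') (scale (\<phi> (b2 * ?S x1)) b1)) a"
        using sweedler_antipode_left_apply[where sV = scale and
            g = "\<lambda>z. scale (\<phi> (b2 * ?S x1)) (b1 * z)" for x1]
        by (simp add: li mult.assoc)
      also have "\<dots> = scale (\<phi> (b2 * ?S a)) b1"
        by (rule sweedler_counit_right) (intro li)
      finally show ?thesis .
    qed
    then show ?thesis by simp
  qed
  finally show ?thesis by simp
qed

lemma sweedler_zero [simp]: "sweedler (\<lambda>_ _. 0) h = 0"
  by (simp add: sweedler_def)

text \<open>The proof rests on \<open>\<phi>(b) h = \<phi>(b S\<^sup>2(h\<^sub>2) S(h\<^sub>1)) h\<^sub>3\<close>.\<close>
lemma left_integral_nondegenerate:
  assumes int: "left_integral \<phi>" and nz: "\<phi> u \<noteq> 0"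
    and zero: "\<And>b. \<phi> (b * antipode h) = 0"
  shows "h = 0"
proof -
  let ?S = antipode
  have \<phi>: "Vector_Spaces.linear scale (*) \<phi>"
    using int by (auto simp: left_integral_def)
  note li = linear_intros linear_compose_left[OF \<phi>]
  \<comment> \<open>At x = h1, y = h2 \<otimes> h3 this is the sum \<phi>(u S(S(h2)) S(h1)) h3. As a
    function of \<open>x\<close> it depends only on the values \<phi>(b S(x)).\<close>
  define t where "t x y = sweedler (\<lambda>p q. scale (\<phi> (u * ?S (?S p) * ?S x)) q) y" for x y
  \<comment> \<open>S(S(x2)) S(x1) is S(x1 S(x2)), hence a counit.\<close>
  have eps: "sweedler (\<lambda>x1 x2. scale (\<phi> (u * ?S (?S x2) * ?S x1)) y) x =
      scale (counit x) (scale (\<phi> u) y)" for x y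
    using sweedler_antipode_right_apply[where g = "\<lambda>z. scale (\<phi> (u * ?S z)) y" and sV = scale]
    by (simp add: li antipode_mult antipode_one mult.assoc)
  have "scale (\<phi> u) h = sweedler (\<lambda>x y. scale (counit x) (scale (\<phi> u) y)) h"
    by (rule sweedler_counit_left[symmetric]) (intro li)
  also have "\<dots> = sweedler (\<lambda>x y. sweedler (\<lambda>x1 x2. scale (\<phi> (u * ?S (?S x2) * ?S x1)) y) x) h"
    by (simp only: eps)
  also have "\<dots> = sweedler t h"
    unfolding t_def by (rule sweedler_coassoc[where sV = scale]) (intro li)+
  also have "\<dots> = 0"
  proof (rule sweedler_eq_0)
    show "bilinear_map scale t" unfolding t_def by (intro li)
  next
    fix \<omega> y assume \<omega>: "Vector_Spaces.linear scale (*) \<omega>"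
    \<comment> \<open>The elements x with \<phi>(b S(x)) = 0 for all b are stable under x \<mapsto>
      x1 \<omega>(x2), because \<phi>(b S(h1)) h2 = b1 \<phi>(b2 S(h)) by strong invariance.\<close>
    have "\<phi> (b * ?S (sweedler (\<lambda>x1 x2. scale (\<omega> x2) x1) h)) = 0" for b
    proof -
      have l: "Vector_Spaces.linear scale (*) (\<lambda>z. \<phi> (b * ?S z))" by (intro li)
      have "\<phi> (b * ?S (sweedler (\<lambda>x1 x2. scale (\<omega> x2) x1) h)) =
          sweedler (\<lambda>x1 x2. \<phi> (b * ?S x1) * \<omega> x2) h"
        by (simp add: sweedler_linear_apply[OF l] linearD(4)[OF l] mult.commute)
      also have "\<dots> = \<omega> (sweedler (\<lambda>x1 x2. scale (\<phi> (b * ?S x1)) x2) h)"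
        by (simp add: sweedler_linear_apply[OF \<omega>] linearD[OF \<omega>])
      also have "\<dots> = 0"
        by (simp add: zero linearD[OF \<omega>] flip: left_integral_antipode[OF int])
      finally show ?thesis .
    qed
    then show "t (sweedler (\<lambda>x1 x2. scale (\<omega> x2) x1) h) y = 0"
      by (simp add: t_def)
  qed
  finally show ?thesis using nz by simp
qed

section \<open>Existence of a nonzero right integral\<close>

text \<open>
  The projection of \<open>\<phi>(u S(-))\<close>, an element of the rational part of the dual, onto the
  coinvariants of that Hopf module.
\<close>
definition induced_right_integral :: "('h \<Rightarrow> 'k) \<Rightarrow> 'h \<Rightarrow> 'h \<Rightarrow> 'k" where
  "induced_right_integral \<phi> u a =
     sweedler (\<lambda>u1 u2. \<phi> (u2 * antipode (antipode (antipode u1) * a))) u"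

text \<open>Write T for the square of S. Since S(u3) T(u2) = S(S(u2) u3) is a counit, it may be
  inserted in front of a2, giving \<phi>(u4 S(T(u1) a1)) S(u3) T(u2) a2. Strong invariance turns the
  factors with T into the leg of a new coproduct of u4, and what remains is S(u2) u3 \<phi>(u4
  S(T(u1) a)), which contracts to a multiple of 1.\<close>

lemma right_integral_induced:
  assumes int: "left_integral \<phi>"
  shows "right_integral (induced_right_integral \<phi> u)"
proof -
  let ?S = antipode
  have \<phi>: "Vector_Spaces.linear scale (*) \<phi>"
    using int by (auto simp: left_integral_def)
  note li = linear_intros linear_compose_left[OF \<phi>]
  define T where "T x = ?S (?S x)" for x
  have T: "Vector_Spaces.linear scale scale T"
    unfolding T_def by (intro li)
  note li = li linear_compose_left[OF T]
  \<comment> \<open>T preserves the order of coproducts, so T(y1) a1 \<otimes> T(y2) a2 is the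
    coproduct of T(y) a; this is strong invariance at that element.\<close>
  have twist: "sweedler (\<lambda>x s. sweedler (\<lambda>a1 a2. scale (\<phi> (v * ?S (T x * a1))) (T s * a2)) a) y =
      sweedler (\<lambda>v1 v2. scale (\<phi> (v2 * ?S (T y * a))) v1) v" for v y a
  proof -
    have b1: "bilinear_map scale (\<lambda>x1 x2. scale (\<phi> (v * ?S x1)) x2)" by (intro li)
    have b2: "bilinear_map scale (\<lambda>p q. sweedler (\<lambda>a1 a2.
        scale (\<phi> (v * ?S (p * a1))) (q * a2)) a)" by (intro li)
    show ?thesis
      unfolding left_integral_antipode[OF int] sweedler_mult[OF b1]
      unfolding T_def sweedler_of_antipode_antipode[OF b2] ..
  qed
  have "sweedler (\<lambda>a1 a2. scale (induced_right_integral \<phi> u a1) a2) a =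
      scale (induced_right_integral \<phi> u a) 1" for a
  proof -
    define Q where "Q u1 w = sweedler (\<lambda>a1 a2. scale (\<phi> (w * ?S (T u1 * a1))) a2) a" for u1 w
    define F where "F u1 s t v =
      sweedler (\<lambda>a1 a2. scale (\<phi> (v * ?S (T u1 * a1))) (?S t * (T s * a2))) a" for u1 s t v
    have Q: "Vector_Spaces.linear scale scale (Q u1)" for u1
      unfolding Q_def by (intro li)
    have eps: "scale (counit x) (Q u1 v) = sweedler (\<lambda>s t. F u1 s t v) x" for x u1 v
    proof -
      have "scale (counit x) (Q u1 v) = sweedler (\<lambda>s t. ?S (?S s * t) * Q u1 v) x"
        using sweedler_antipode_left_apply[where g = "\<lambda>z. ?S z * Q u1 v" and sV = scale]
        by (simp add: li antipode_one)
      also have "\<dots> = sweedler (\<lambda>s t. F u1 s t v) x"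
        by (simp add: antipode_mult Q_def F_def T_def mult.assoc scale_mult_right
            sweedler_linear_apply[OF linear_mult_right[OF linear_id]])
      finally show ?thesis .
    qed
    have Q_expand: "Q u1 w = sweedler (\<lambda>s y. sweedler (\<lambda>t v. F u1 s t v) y) w" for u1 w
    proof -
      have "Q u1 w = sweedler (\<lambda>x v. scale (counit x) (Q u1 v)) w"
        by (rule sweedler_counit_left[symmetric]) (rule Q)
      also have "\<dots> = sweedler (\<lambda>x v. sweedler (\<lambda>s t. F u1 s t v) x) w"
        by (simp only: eps)
      also have "\<dots> = sweedler (\<lambda>s y. sweedler (\<lambda>t v. F u1 s t v) y) w"
        unfolding F_def by (rule sweedler_coassoc[where sV = scale]) (intro li)+
      finally show ?thesis .
    qed
    \<comment> \<open>\<open>twist\<close> removes the legs of \<open>x\<close>; the new leg of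
      \<open>v\<close> then meets S(t), and coassociativity makes the two a counit.\<close>
    have collapse: "sweedler (\<lambda>t v. sweedler (\<lambda>u1 s. F u1 s t v) x) y =
        scale (\<phi> (y * ?S (T x * a))) 1" for x y
    proof -
      have "sweedler (\<lambda>u1 s. F u1 s t v) x =
          sweedler (\<lambda>v1 v2. scale (\<phi> (v2 * ?S (T x * a))) (?S t * v1)) v" for t v
      proof -
        have "sweedler (\<lambda>u1 s. F u1 s t v) x = ?S t * sweedler (\<lambda>u1 s.
            sweedler (\<lambda>a1 a2. scale (\<phi> (v * ?S (T u1 * a1))) (T s * a2)) a) x"
          by (simp add: F_def scale_mult_right
              sweedler_linear_apply[OF linear_mult_right[OF linear_id]])
        also have "\<dots> = sweedler (\<lambda>v1 v2. scale (\<phi> (v2 * ?S (T x * a))) (?S t * v1)) v"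
          by (simp add: twist scale_mult_right
              sweedler_linear_apply[OF linear_mult_right[OF linear_id]])
        finally show ?thesis .
      qed
      then have "sweedler (\<lambda>t v. sweedler (\<lambda>u1 s. F u1 s t v) x) y =
          sweedler (\<lambda>t v. sweedler (\<lambda>v1 v2. scale (\<phi> (v2 * ?S (T x * a))) (?S t * v1)) v) y"
        by simp
      also have "\<dots> =
          sweedler (\<lambda>z v2. sweedler (\<lambda>t v1. scale (\<phi> (v2 * ?S (T x * a))) (?S t * v1)) z) y"
        by (rule sweedler_coassoc[symmetric, where sV = scale]) (intro li)+
      also have "\<dots> = sweedler (\<lambda>z v2. scale (counit z) (scale (\<phi> (v2 * ?S (T x * a))) 1)) y"
        by (subst sweedler_antipode_left_apply[where sV = scale]) (intro li refl)+
      also have "\<dots> = scale (\<phi> (y * ?S (T x * a))) 1"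
        by (rule sweedler_counit_left) (intro li)
      finally show ?thesis .
    qed
    have "sweedler (\<lambda>a1 a2. scale (induced_right_integral \<phi> u a1) a2) a = sweedler Q u"
      unfolding induced_right_integral_def T_def[symmetric] Q_def
        sweedler_linear_apply[OF linear_scale_field] by (rule sweedler_swap)
    also have "\<dots> = sweedler (\<lambda>u1 w. sweedler (\<lambda>s y. sweedler (\<lambda>t v. F u1 s t v) y) w) u"
      by (simp only: Q_expand[abs_def])
    also have "\<dots> = sweedler (\<lambda>x y. sweedler (\<lambda>u1 s. sweedler (\<lambda>t v. F u1 s t v) y) x) u"
      unfolding F_def by (rule sweedler_coassoc[symmetric, where sV = scale]) (intro li)+
    also have "\<dots> = sweedler (\<lambda>x y. sweedler (\<lambda>t v. sweedler (\<lambda>u1 s. F u1 s t v) x) y) u"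
      by (subst sweedler_swap) (rule refl)
    also have "\<dots> = scale (induced_right_integral \<phi> u a) 1"
      by (simp add: collapse induced_right_integral_def T_def
          sweedler_linear_apply[OF linear_scale_field])
    finally show ?thesis .
  qed
  moreover have "Vector_Spaces.linear scale (*) (induced_right_integral \<phi> u)"
    unfolding induced_right_integral_def by (intro li)
  ultimately show ?thesis by (simp add: right_integral_def)
qed

text \<open>The sum of the values of the integrals induced by u2 at S(u1) is \<phi>(u3 S(S(u1
  S(u2)))) = \<phi>(u). Being nonzero, it has an induced integral that does not vanish.\<close>

lemma exists_right_integral:
  assumes int: "left_integral \<phi>" and nz: "\<phi> u \<noteq> 0"
  shows "\<exists>\<psi> b. right_integral \<psi> \<and> \<psi> b \<noteq> 0"
proof -
  let ?S = antipode
  have \<phi>: "Vector_Spaces.linear scale (*) \<phi>"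
    using int by (auto simp: left_integral_def)
  note li = linear_intros linear_compose_left[OF \<phi>]
  have "\<phi> u = sweedler (\<lambda>x u3. counit x * \<phi> u3) u"
    by (rule sweedler_counit_left[symmetric]) (rule \<phi>)
  also have "\<dots> = sweedler (\<lambda>x u3. sweedler (\<lambda>u1 u2. \<phi> (u3 * ?S (?S (?S u2) * ?S u1))) x) u"
    using sweedler_antipode_right_apply[where g = "\<lambda>z. \<phi> (u3 * ?S (?S z))" and sV = "(*)" for u3]
    by (simp add: li antipode_one antipode_mult)
  also have "\<dots> = sweedler (\<lambda>u1 w. induced_right_integral \<phi> w (?S u1)) u"
    unfolding induced_right_integral_def
    by (rule sweedler_coassoc[where sV = "(*)"]) (intro li)+
  finally have "sweedler (\<lambda>u1 w. induced_right_integral \<phi> w (?S u1)) u \<noteq> 0"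
    using nz by simp
  then have "\<exists>w b. induced_right_integral \<phi> w b \<noteq> 0"
    by (rule contrapos_np) simp
  then show ?thesis using right_integral_induced[OF int] by blast
qed

section \<open>Proportionality and uniqueness\<close>

lemma right_integral_eq_antipode:
  assumes int: "left_integral \<phi>" and nz: "\<phi> u \<noteq> 0" and "right_integral \<psi>"
  shows "\<exists>c. \<forall>a. \<psi> a = c * \<phi> (antipode a)"
proof -
  let ?S = antipode
  have \<phi>: "Vector_Spaces.linear scale (*) \<phi>"
    using int by (auto simp: left_integral_def)
  have \<psi>: "Vector_Spaces.linear scale (*) \<psi>"
    and inv: "\<And>h. sweedler (\<lambda>x y. scale (\<psi> x) y) h = scale (\<psi> h) 1"
    using \<open>right_integral \<psi>\<close> by (auto simp: right_integral_def)
  define D where "D a = sweedler (\<lambda>x y. scale (\<psi> y) x) a" for a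
  \<comment> \<open>\<psi> is applied to both sides of strong invariance; right invariance of \<psi>
    then extracts \<psi>(b).\<close>
  have D: "\<phi> (b * ?S (D a)) = \<psi> b * \<phi> (?S a)" for a b
  proof -
    have l: "Vector_Spaces.linear scale (*) (\<lambda>z. \<phi> (b * ?S z))"
      by (intro linear_intros linear_compose_left[OF \<phi>])
    have r: "Vector_Spaces.linear scale (*) (\<lambda>z. \<phi> (z * ?S a))"
      by (intro linear_intros linear_compose_left[OF \<phi>])
    have "\<phi> (b * ?S (D a)) = sweedler (\<lambda>x y. \<phi> (b * ?S x) * \<psi> y) a"
      by (simp add: D_def sweedler_linear_apply[OF l] linearD(4)[OF l] mult.commute)
    also have "\<dots> = \<psi> (sweedler (\<lambda>x y. scale (\<phi> (b * ?S x)) y) a)"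
      by (simp add: sweedler_linear_apply[OF \<psi>] linearD[OF \<psi>])
    also have "\<dots> = sweedler (\<lambda>b1 b2. \<psi> b1 * \<phi> (b2 * ?S a)) b"
      by (simp add: sweedler_linear_apply[OF \<psi>] linearD[OF \<psi>] mult.commute
          flip: left_integral_antipode[OF int])
    also have "\<dots> = \<phi> (sweedler (\<lambda>x y. scale (\<psi> x) y) b * ?S a)"
      by (simp add: sweedler_linear_apply[OF r] linearD(4)[OF r])
    also have "\<dots> = \<psi> b * \<phi> (?S a)"
      by (simp add: inv linearD(4)[OF r])
    finally show ?thesis .
  qed
  have counit_D: "counit (D a) = \<psi> a" for a
    using sweedler_counit_left[OF \<psi>, of a]
    by (simp add: D_def sweedler_linear_apply[OF counit_linear] counit_simps mult.commute)
  have proportional: "\<phi> (?S a') * \<psi> a = \<phi> (?S a) * \<psi> a'" for a a'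
  proof -
    \<comment> \<open>By \<open>D\<close> both terms contribute \<psi>(b) \<phi>(S(a))
      \<phi>(S(a')), so nondegeneracy forces the difference to vanish.\<close>
    have "\<phi> (b * ?S (scale (\<phi> (?S a')) (D a) - scale (\<phi> (?S a)) (D a'))) = 0" for b
    proof -
      have l: "Vector_Spaces.linear scale (*) (\<lambda>z. \<phi> (b * ?S z))"
        by (intro linear_intros linear_compose_left[OF \<phi>])
      show ?thesis by (simp add: linearD(4,5)[OF l] D)
    qed
    from left_integral_nondegenerate[OF int nz this]
    have "counit (scale (\<phi> (?S a')) (D a)) = counit (scale (\<phi> (?S a)) (D a'))" by simp
    then show ?thesis by (simp add: counit_simps counit_D)
  qed
  show ?thesis
  proof (cases "\<exists>a'. \<phi> (?S a') \<noteq> 0")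
    case True
    then obtain a' where "\<phi> (?S a') \<noteq> 0" by blast
    then have "\<psi> a = \<psi> a' / \<phi> (?S a') * \<phi> (?S a)" for a
      using proportional[of a' a] by (simp add: field_simps)
    then show ?thesis by blast
  next
    case False
    \<comment> \<open>If \<phi> vanishes on the image of S, nondegeneracy kills \<open>D a\<close>,
      and with it \<psi>(a), its counit.\<close>
    then have "D a = 0" for a
      using left_integral_nondegenerate[OF int nz, of "D a"] by (simp add: D)
    then have "\<psi> a = 0" for a
      using counit_D[of a] by (simp add: counit_simps)
    then show ?thesis by (intro exI[of _ 0]) simp
  qed
qed

lemma left_integral_diff_scale:
  assumes "left_integral \<phi>" "left_integral \<phi>'"
  shows "left_integral (\<phi>' - dual_scale d \<phi>)"
proof -
  have \<phi>: "Vector_Spaces.linear scale (*) \<phi>" "Vector_Spaces.linear scale (*) \<phi>'"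
    using assms by (auto simp: left_integral_def)
  have "Vector_Spaces.linear scale (*) (\<phi>' - dual_scale d \<phi>)"
    by (rule linearI) (auto simp: vector_space_axioms vector_space_mult dual_scale_def
        linearD[OF \<phi>(1)] linearD[OF \<phi>(2)] algebra_simps)
  moreover have "sweedler (\<lambda>x y. scale (\<phi>' y - d * \<phi> y) x) h =
      sweedler (\<lambda>x y. scale (\<phi>' y) x) h - scale d (sweedler (\<lambda>x y. scale (\<phi> y) x) h)" for h
    by (simp add: sweedler_def case_prod_unfold scale_left_diff_distrib sum_subtractf
        scale_sum_right mult.assoc)
  ultimately show ?thesis
    using assms by (simp add: left_integral_def dual_scale_def scale_left_diff_distrib)
qed

lemma left_integral_unique:
  assumes int: "left_integral \<phi>" "left_integral \<phi>'" and nz: "\<phi> u \<noteq> 0"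
  shows "\<exists>d. \<phi>' = dual_scale d \<phi>"
proof -
  obtain \<psi> b where \<psi>: "right_integral \<psi>" "\<psi> b \<noteq> 0"
    using exists_right_integral[OF int(1) nz] by blast
  \<comment> \<open>The fixed \<psi> is a multiple of \<chi> composed with S for every nonzero left
    integral \<chi>; as \<psi>(b) is nonzero, such a \<chi> cannot vanish at S(b).\<close>
  have key: "\<exists>c. c \<noteq> 0 \<and> (\<forall>a. \<psi> a = c * \<chi> (antipode a))"
    if "left_integral \<chi>" "\<chi> \<noteq> 0" for \<chi>
  proof -
    obtain v where "\<chi> v \<noteq> 0" using \<open>\<chi> \<noteq> 0\<close> by (auto simp: fun_eq_iff)
    from right_integral_eq_antipode[OF that(1) this \<psi>(1)] \<psi>(2) show ?thesis
      by (metis mult_zero_left)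
  qed
  show ?thesis
  proof (cases "\<phi>' = 0")
    case True
    then show ?thesis by (intro exI[of _ 0]) (simp add: dual_scale_def fun_eq_iff)
  next
    case False
    obtain c where c: "c \<noteq> 0" "\<And>a. \<psi> a = c * \<phi> (antipode a)"
      using key[OF int(1)] nz by (auto simp: fun_eq_iff)
    obtain c' where c': "c' \<noteq> 0" "\<And>a. \<psi> a = c' * \<phi>' (antipode a)"
      using key[OF int(2) False] by blast
    \<comment> \<open>The factor is chosen so that \<chi> vanishes at S(b): both c \<phi>(S(b)) and
      c' \<phi>'(S(b)) equal \<psi>(b). By \<open>key\<close> this single zero already gives \<chi>
      = 0, without cancelling S.\<close>
    define \<chi> where "\<chi> = \<phi>' - dual_scale (c / c') \<phi>"
    have "c' * \<chi> (antipode b) = 0"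
      using c(2)[of b] c'(2)[of b] c'(1) by (simp add: \<chi>_def dual_scale_def field_simps)
    then have "\<chi> (antipode b) = 0" using c' by simp
    moreover have "left_integral \<chi>"
      unfolding \<chi>_def by (rule left_integral_diff_scale[OF int])
    ultimately have "\<chi> = 0" using key[of \<chi>] \<psi>(2) by (metis mult_zero_right)
    then show ?thesis by (auto simp: \<chi>_def)
  qed
qed

end

section \<open>From proportionality to the dimension bound\<close>

theorem corollary5:
  fixes scale :: "'k::field \<Rightarrow> 'h::ring_1 \<Rightarrow> 'h"
    and comult :: "'h \<Rightarrow> ('h \<times> 'h \<Rightarrow>\<^sub>0 'k) set"
    and counit :: "'h \<Rightarrow> 'k"
    and antipode :: "'h \<Rightarrow> 'h"
  assumes "hopf_algebra scale comult counit antipode"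
  shows "(\<exists>B. finite B \<and> \<not> module.dependent dual_scale B \<and>
              module.span dual_scale B = left_integrals scale comult) \<and>
         vector_space.dim dual_scale (left_integrals scale comult) \<le> 1"
proof -
  interpret hopf_algebra scale comult counit antipode by fact
  interpret dual: vector_space "dual_scale :: 'k \<Rightarrow> ('h \<Rightarrow> 'k) \<Rightarrow> _"
    by (rule vector_space_dual_scale)
  have zero: "left_integral 0"
    by (auto simp: left_integral_def zero_fun_def intro!: linearI vector_space_axioms
        vector_space_mult)
  \<comment> \<open>Finiteness of the basis is carried along because \<open>card\<close> of an
    infinite set is 0, so a bound on \<open>dim\<close> alone would not exclude infinite
    dimension.\<close>
  have "\<exists>B. finite B \<and> card B \<le> 1 \<and> dual.independent B \<and>
      dual.span B = left_integrals scale comult"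
  proof (cases "\<exists>\<phi> u. left_integral \<phi> \<and> \<phi> u \<noteq> 0")
    case False
    then have "left_integrals scale comult = {0}"
      using zero by (auto simp: left_integrals_eq fun_eq_iff)
    then show ?thesis
      by (intro exI[of _ "{}"]) (simp add: dual.independent_empty)
  next
    case True
    then obtain \<phi> u where \<phi>: "left_integral \<phi>" "\<phi> u \<noteq> 0" by blast
    \<comment> \<open>The multiple is obtained as the zero integral minus (-d) times \<phi>.\<close>
    have "left_integral (dual_scale d \<phi>)" for d
      using left_integral_diff_scale[OF \<phi>(1) zero, of "- d"] by simp
    then have "dual.span {\<phi>} = left_integrals scale comult"
      using left_integral_unique[OF \<phi>(1) _ \<phi>(2)]
      by (fastforce simp: dual.span_singleton left_integrals_eq)
    moreover have "dual.independent {\<phi>}"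
      using \<phi>(2) by (auto simp: dual.dependent_single)
    ultimately show ?thesis
      by (intro exI[of _ "{\<phi>}"]) simp
  qed
  then obtain B where B: "finite B" "card B \<le> 1" "dual.independent B"
    "dual.span B = left_integrals scale comult" by blast
  moreover have "dual.dim (left_integrals scale comult) = card B"
    using dual.dim_span_eq_card_independent[OF B(3)] by (simp add: B(4))
  ultimately show ?thesis by auto
qed

end
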